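(* Let $F$ be a bipartite graph with $m$ edges and no isolated vertices. Then, for every integer $k\ge 2$, \[ r_k(F)\le 2^6\, m^{3/2}\, k^{2\sqrt{km}+1/2}. \]
   Context: Graphs are finite and simple. For a graph $F$ and a positive integer $k$, the multicolor Ramsey number $r_k(F)$ is the least integer $n$ such that in every coloring of the edges of the complete graph $K_n$ by $k$ colors there is a monochromatic copy of $F$, i.e. a (not necessarily induced) subgraph of $K_n$ isomorphic to $F$ all of whose edges have the same color. *)

theory Defs
  imports "HOL-Analysis.Analysis" "HOL-Library.Ramsey"
begin

definition simple_graph :: "'a set \<Rightarrow> 'a set set \<Rightarrow> bool" where
  "simple_graph V E \<longleftrightarrow> finite V \<and> E \<subseteq> [V]\<^bsup>2\<^esup>"

definition isolated :: "'a set set \<Rightarrow> 'a \<Rightarrow> bool" where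
  "isolated E v \<longleftrightarrow> (\<forall>e\<in>E. v \<notin> e)"

definition bipartite :: "'a set \<Rightarrow> 'a set set \<Rightarrow> bool" where
  "bipartite V E \<longleftrightarrow>
     (\<exists>A B. A \<union> B = V \<and> A \<inter> B = {} \<and> (\<forall>e\<in>E. \<exists>a\<in>A. \<exists>b\<in>B. e = {a, b}))"

definition subgraph :: "'a set \<Rightarrow> 'a set set \<Rightarrow> 'a set \<Rightarrow> 'a set set \<Rightarrow> bool" where
  "subgraph W D V E \<longleftrightarrow> simple_graph W D \<and> W \<subseteq> V \<and> D \<subseteq> E"

definition graph_isomorphic :: "'a set \<Rightarrow> 'a set set \<Rightarrow> 'b set \<Rightarrow> 'b set set \<Rightarrow> bool" where
  "graph_isomorphic V E W D \<longleftrightarrow>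
     (\<exists>f. bij_betw f V W \<and> (\<forall>x\<in>V. \<forall>y\<in>V. {x, y} \<in> E \<longleftrightarrow> {f x, f y} \<in> D))"

text \<open>The complete graph \<open>K\<^sub>n\<close> has vertex set \<open>{..<n}\<close> and edge set
  \<open>[{..<n}]\<^bsup>2\<^esup>\<close>; a colouring by \<open>k\<close> colours need not use all of them.\<close>

definition monochromatic_copy ::
    "nat \<Rightarrow> (nat set \<Rightarrow> nat) \<Rightarrow> 'a set \<Rightarrow> 'a set set \<Rightarrow> bool" where
  "monochromatic_copy n c V E \<longleftrightarrow>
     (\<exists>W D. subgraph W D {..<n} ([{..<n}]\<^bsup>2\<^esup>) \<and> graph_isomorphic V E W D \<and>
        (\<exists>i. \<forall>e\<in>D. c e = i))"

definition ramsey_property :: "nat \<Rightarrow> 'a set \<Rightarrow> 'a set set \<Rightarrow> nat \<Rightarrow> bool" where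
  "ramsey_property k V E n \<longleftrightarrow>
     (\<forall>c \<in> [{..<n}]\<^bsup>2\<^esup> \<rightarrow> {..<k}. monochromatic_copy n c V E)"

definition ramsey_number :: "nat \<Rightarrow> 'a set \<Rightarrow> 'a set set \<Rightarrow> nat" where
  "ramsey_number k V E = (LEAST n. ramsey_property k V E n)"

text \<open>By Ramsey's theorem the minimum exists, so \<^const>\<open>ramsey_number\<close> is never the
  unspecified value of \<^const>\<open>Least\<close> on a finite simple graph.\<close>

lemma ramsey_property_ex:
  assumes "simple_graph V E"
  shows "\<exists>n. ramsey_property k V E n"
proof -
  obtain n where n: "partn_lst {..<n::nat} (replicate k (card V)) 2"
    using ramsey_full by blast
  have "monochromatic_copy n c V E" if c: "c \<in> [{..<n}]\<^bsup>2\<^esup> \<rightarrow> {..<k}" for c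
  proof -
    obtain i H where "i < k" and H: "H \<in> nsets {..<n} (card V)" and i: "c ` ([H]\<^bsup>2\<^esup>) \<subseteq> {i}"
      using partn_lstE[OF n c] by (metis length_replicate nth_replicate)
    have fin: "finite V" "finite H" "card V = card H" "H \<subseteq> {..<n}"
      using assms H by (auto simp: simple_graph_def nsets_def)
    then obtain f where f: "bij_betw f V H"
      by (metis finite_same_card_bij)
    then have inj: "inj_on f V"
      by (rule bij_betw_imp_inj_on)
    define D where "D = (`) f ` E"
    have EV: "E \<subseteq> [V]\<^bsup>2\<^esup>"
      using assms by (simp add: simple_graph_def)
    have "(`) f ` ([V]\<^bsup>2\<^esup>) = [H]\<^bsup>2\<^esup>"
      using bij_betw_nsets[OF f] by (rule bij_betw_imp_surj_on)
    then have DH: "D \<subseteq> [H]\<^bsup>2\<^esup>"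
      using EV image_mono unfolding D_def by metis
    have sub: "subgraph H D {..<n} ([{..<n}]\<^bsup>2\<^esup>)"
      using fin DH nsets_mono[OF fin(4), of 2] unfolding subgraph_def simple_graph_def by simp
    have "{x, y} \<in> E \<longleftrightarrow> {f x, f y} \<in> D" if xy: "x \<in> V" "y \<in> V" for x y
    proof
      assume "{f x, f y} \<in> D"
      then obtain e where e: "e \<in> E" "{f x, f y} = f ` e"
        unfolding D_def by (rule imageE)
      have "e \<subseteq> V"
        using e(1) EV by (auto simp: nsets_def)
      moreover have "{x, y} \<subseteq> V" "f ` {x, y} = f ` e"
        using xy e(2) by simp_all
      ultimately have "{x, y} = e"
        using inj_on_image_eq_iff[OF inj] by metis
      then show "{x, y} \<in> E"
        using e(1) by simp
    next
      assume "{x, y} \<in> E"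
      then have "f ` {x, y} \<in> D"
        unfolding D_def by (rule imageI)
      then show "{f x, f y} \<in> D"
        by simp
    qed
    then have iso: "graph_isomorphic V E H D"
      using f unfolding graph_isomorphic_def by (intro exI[of _ f]) simp
    have "\<forall>e\<in>D. c e = i"
      using i DH by (simp add: image_subset_iff subset_iff)
    then show ?thesis
      using sub iso unfolding monochromatic_copy_def by (intro exI[of _ H] exI[of _ D] exI[of _ i] conjI)
  qed
  then show ?thesis
    unfolding ramsey_property_def by (intro exI[of _ n]) simp
qed

end

theory Submission
  imports Defs
begin

text \<open>
  Let \<open>s = sqrt (k * m)\<close> and \<open>D = floor s\<close>. At most \<open>s / k\<close> vertices in the part \<open>A\<close> have degree above
  \<open>D\<close>. Passing repeatedly to neighbourhoods, at a cost of a factor \<open>k\<close> per vertex and hence of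
  at most \<open>k powr s\<close> in total, one finds a colour \<open>i\<close>, enough vertices to host these high-degree
  vertices, and a set \<open>U\<close> that is joined to them in colour \<open>i\<close> and itself of density \<open>1 / k\<close> in that colour.
  The rest of the graph has degrees at most \<open>D\<close> on the side of \<open>A\<close> and is embedded into \<open>U\<close> by dependent
  random choice: in the common neighbourhood \<open>W\<close> of two random vertices almost every tuple of at
  most \<open>D\<close> vertices has many common neighbours, so a random map from \<open>B\<close> to \<open>W\<close> is, with positive
  probability, injective and good at every vertex of \<open>A\<close>.
\<close>

section \<open>Dependent random choice for a symmetric relation\<close>

text \<open>Convexity of the \<open>D\<close>-th power via Bernoulli: the power lies above its
  tangent at \<open>\<mu>\<close>. As \<open>\<mu>\<close> is only a lower bound for the mean, the
  linear terms of the tangents add up to something nonnegative.\<close>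

lemma card_mult_power_le_sum_power:
  fixes x :: "'i \<Rightarrow> real"
  assumes "\<And>i. i \<in> I \<Longrightarrow> 0 \<le> x i" and "0 < \<mu>" and "real (card I) * \<mu> \<le> sum x I"
  shows "real (card I) * \<mu> ^ D \<le> (\<Sum>i\<in>I. x i ^ D)"
proof -
  have tangent: "\<mu> ^ D * (1 + real D * (x i / \<mu> - 1)) \<le> x i ^ D" if "i \<in> I" for i
  proof -
    have "\<mu> ^ D * (1 + real D * (x i / \<mu> - 1)) \<le> \<mu> ^ D * (1 + (x i / \<mu> - 1)) ^ D"
      using assms(1)[OF that] assms(2) by (intro mult_left_mono Bernoulli_inequality) auto
    also have "\<dots> = x i ^ D"
      using assms(2) by (simp add: power_divide)
    finally show ?thesis .
  qed
  have "real (card I) * \<mu> ^ D \<le> \<mu> ^ D * (real (card I) + real D * (sum x I / \<mu> - real (card I)))"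
  proof -
    have "0 \<le> sum x I / \<mu> - real (card I)"
      using assms(2,3) by (simp add: field_simps)
    then have "0 \<le> \<mu> ^ D * (real D * (sum x I / \<mu> - real (card I)))"
      using assms(2) by simp
    then show ?thesis
      by (simp add: algebra_simps)
  qed
  also have "\<dots> = (\<Sum>i\<in>I. \<mu> ^ D * (1 + real D * (x i / \<mu> - 1)))"
    by (simp add: sum.distrib sum_subtractf sum_divide_distrib sum_distrib_left algebra_simps)
  also have "\<dots> \<le> (\<Sum>i\<in>I. x i ^ D)"
    using tangent by (rule sum_mono)
  finally show ?thesis .
qed

definition common_nbrs :: "('b \<Rightarrow> 'b \<Rightarrow> bool) \<Rightarrow> 'b set \<Rightarrow> 'b set \<Rightarrow> 'b set" where
  "common_nbrs R U S = {x \<in> U. \<forall>y\<in>S. R y x}"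

lemma common_nbrs_subset: "common_nbrs R U S \<subseteq> U"
  by (auto simp: common_nbrs_def)

lemma finite_common_nbrs: "finite U \<Longrightarrow> finite (common_nbrs R U S)"
  by (simp add: common_nbrs_def)

text \<open>Double counting. By symmetry, \<open>g\<close> maps into the common neighbourhood of
  \<open>x\<close> and \<open>y\<close> only if both \<open>x\<close> and \<open>y\<close> lie in
  the common neighbourhood of the image of \<open>g\<close>. For a bad \<open>g\<close> this set has
  fewer than \<open>c\<close> elements, so \<open>g\<close> is counted for at most
  \<open>c ^ 2\<close> pairs.\<close>

lemma sum_bad_maps_le:
  fixes R :: "'b \<Rightarrow> 'b \<Rightarrow> bool" and I :: "'c set"
  assumes "finite U" and sym: "\<And>x y. R x y \<Longrightarrow> R y x" and "finite I"
  shows "(\<Sum>(x, y)\<in>U \<times> U. card {g \<in> I \<rightarrow>\<^sub>E common_nbrs R U {x, y}. card (common_nbrs R U (g ` I)) < c})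
    \<le> card U ^ card I * c ^ 2"
proof -
  define G where "G = {g \<in> I \<rightarrow>\<^sub>E U. card (common_nbrs R U (g ` I)) < c}"
  have finG: "finite G"
    unfolding G_def by (rule rev_finite_subset[OF finite_PiE[OF assms(3), of "\<lambda>_. U"]]) (use assms(1) in auto)
  have "{g \<in> I \<rightarrow>\<^sub>E common_nbrs R U {x, y}. card (common_nbrs R U (g ` I)) < c}
      = {g \<in> G. g \<in> I \<rightarrow>\<^sub>E common_nbrs R U {x, y}}" for x y
    using common_nbrs_subset[of R U "{x, y}"] unfolding G_def by (auto simp: PiE_iff)
  then have "(\<Sum>(x, y)\<in>U \<times> U. card {g \<in> I \<rightarrow>\<^sub>E common_nbrs R U {x, y}. card (common_nbrs R U (g ` I)) < c})
      = (\<Sum>p\<in>U \<times> U. card {g \<in> G. g \<in> I \<rightarrow>\<^sub>E common_nbrs R U {fst p, snd p}})"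
    by (simp add: case_prod_beta)
  also have "\<dots> = (\<Sum>g\<in>G. card {p \<in> U \<times> U. g \<in> I \<rightarrow>\<^sub>E common_nbrs R U {fst p, snd p}})"
    using assms(1) finG by (intro sum_multicount_gen) auto
  also have "\<dots> \<le> (\<Sum>g\<in>G. c ^ 2)"
  proof (rule sum_mono)
    fix g assume g: "g \<in> G"
    have "{p \<in> U \<times> U. g \<in> I \<rightarrow>\<^sub>E common_nbrs R U {fst p, snd p}}
        \<subseteq> common_nbrs R U (g ` I) \<times> common_nbrs R U (g ` I)"
      using sym by (auto simp: common_nbrs_def PiE_iff)
    then have "card {p \<in> U \<times> U. g \<in> I \<rightarrow>\<^sub>E common_nbrs R U {fst p, snd p}}
        \<le> card (common_nbrs R U (g ` I) \<times> common_nbrs R U (g ` I))"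
      using assms(1) by (intro card_mono) (simp_all add: finite_common_nbrs)
    also have "\<dots> \<le> c ^ 2"
      using g unfolding G_def by (auto simp: card_cartesian_product power2_eq_square intro!: mult_mono)
    finally show "card {p \<in> U \<times> U. g \<in> I \<rightarrow>\<^sub>E common_nbrs R U {fst p, snd p}} \<le> c ^ 2" .
  qed
  also have "\<dots> = card G * c ^ 2"
    by simp
  also have "\<dots> \<le> card U ^ card I * c ^ 2"
  proof -
    have "card G \<le> card (I \<rightarrow>\<^sub>E U)"
      using assms unfolding G_def by (intro card_mono finite_PiE) auto
    then show ?thesis
      using assms by (simp add: card_funcsetE)
  qed
  finally show ?thesis .
qed

text \<open>A vertex \<open>z\<close> lies in the common neighbourhood of exactly
  \<open>d z ^ 2\<close> ordered pairs, and the degrees \<open>d z\<close> have mean at least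
  \<open>N / k\<close>. Convexity of the square then bounds the average over all pairs, equal
  entries included.\<close>

lemma sum_card_common_nbrs_pairs:
  fixes R :: "'b \<Rightarrow> 'b \<Rightarrow> bool" and k :: real
  assumes "finite U" and "U \<noteq> {}" and sym: "\<And>x y. R x y \<Longrightarrow> R y x" and "0 < k"
    and dens: "real (card U) ^ 2 \<le> k * (\<Sum>x\<in>U. real (card (common_nbrs R U {x})))"
  shows "real (card (U \<times> U)) * (real (card U) / k ^ 2)
    \<le> (\<Sum>p\<in>U \<times> U. real (card (common_nbrs R U {fst p, snd p})))"
proof -
  define N where "N = real (card U)"
  define d where "d z = real (card (common_nbrs R U {z}))" for z
  have N: "0 < N"
    using assms(1,2) unfolding N_def by (simp add: card_gt_0_iff)
  have "N / k * N \<le> sum d U"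
    using dens assms(4) unfolding N_def d_def by (simp add: field_simps power2_eq_square)
  then have "N * (N / k) ^ 2 \<le> (\<Sum>z\<in>U. d z ^ 2)"
    using N assms(4) unfolding N_def
    by (intro card_mult_power_le_sum_power) (auto simp: d_def mult.commute)
  also have "\<dots> = (\<Sum>z\<in>U. real (card {p \<in> U \<times> U. z \<in> common_nbrs R U {fst p, snd p}}))"
  proof (rule sum.cong[OF refl])
    fix z assume "z \<in> U"
    then have "{p \<in> U \<times> U. z \<in> common_nbrs R U {fst p, snd p}} = common_nbrs R U {z} \<times> common_nbrs R U {z}"
      using sym by (auto simp: common_nbrs_def)
    then show "d z ^ 2 = real (card {p \<in> U \<times> U. z \<in> common_nbrs R U {fst p, snd p}})"
      by (simp add: d_def card_cartesian_product power2_eq_square)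
  qed
  also have "\<dots> = real (\<Sum>z\<in>U. card {p \<in> U \<times> U. z \<in> common_nbrs R U {fst p, snd p}})"
    by simp
  also have "(\<Sum>z\<in>U. card {p \<in> U \<times> U. z \<in> common_nbrs R U {fst p, snd p}})
      = (\<Sum>p\<in>U \<times> U. card {z \<in> U. z \<in> common_nbrs R U {fst p, snd p}})"
    using assms(1) by (intro sum_multicount_gen) auto
  also have "\<dots> = (\<Sum>p\<in>U \<times> U. card (common_nbrs R U {fst p, snd p}))"
    by (intro sum.cong arg_cong[of _ _ card]) (auto simp: common_nbrs_def)
  finally show ?thesis
    by (simp add: N_def card_cartesian_product power2_eq_square field_simps)
qed

text \<open>First moment argument over a uniformly random ordered pair \<open>p\<close> with common
  neighbourhood \<open>W p\<close>. With \<open>\<mu> = N / k ^ 2\<close>, the mean of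
  \<open>card (W p) ^ D\<close> is at least \<open>\<mu> ^ D\<close>. Bad maps are rare, because
  both vertices of the pair must fall into a set of size below \<open>c\<close>; by
  \<open>big\<close>, twice their weighted mean is at most \<open>\<mu> ^ D / 2\<close>.\<close>

lemma dependent_random_choice:
  fixes R :: "'b \<Rightarrow> 'b \<Rightarrow> bool" and k :: real and \<Gamma> :: "'a \<Rightarrow> 'c set"
  assumes "finite U" and "U \<noteq> {}" and sym: "\<And>x y. R x y \<Longrightarrow> R y x" and "0 < k"
    and dens: "real (card U) ^ 2 \<le> k * (\<Sum>x\<in>U. real (card (common_nbrs R U {x})))"
    and "finite A" and fin: "\<And>a. a \<in> A \<Longrightarrow> finite (\<Gamma> a)" and deg: "\<And>a. a \<in> A \<Longrightarrow> card (\<Gamma> a) \<le> D"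
    and "1 \<le> D" and big: "4 * real (card A) * real c ^ 2 * k ^ (2 * D) \<le> real (card U) ^ 2"
  obtains W where "W \<subseteq> U" and "real (card U) \<le> 2 * k ^ 2 * real (card W)"
    and "2 * (\<Sum>a\<in>A. card W ^ (D - card (\<Gamma> a))
      * card {g \<in> \<Gamma> a \<rightarrow>\<^sub>E W. card (common_nbrs R U (g ` \<Gamma> a)) < c}) \<le> card W ^ D"
proof -
  define N where "N = real (card U)"
  define \<mu> where "\<mu> = N / k ^ 2"
  define W where "W p = common_nbrs R U {fst p, snd p}" for p
  define bad where "bad p a = card {g \<in> \<Gamma> a \<rightarrow>\<^sub>E W p. card (common_nbrs R U (g ` \<Gamma> a)) < c}" for p a
  \<comment> \<open>The weight turns the number of bad maps on \<open>\<Gamma> a\<close> into their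
    proportion times \<open>card (W p) ^ D\<close>, so that all degrees up to \<open>D\<close> are
    compared with the same moment.\<close>
  define B where "B p = (\<Sum>a\<in>A. card (W p) ^ (D - card (\<Gamma> a)) * bad p a)" for p
  have N: "0 < N"
    using assms(1,2) unfolding N_def by (simp add: card_gt_0_iff)
  have \<mu>: "0 < \<mu>"
    using N assms(4) unfolding \<mu>_def by simp
  have cardUU: "real (card (U \<times> U)) = N ^ 2"
    by (simp add: N_def card_cartesian_product power2_eq_square)
  have W_le: "card (W p) \<le> card U" for p
    using assms(1) common_nbrs_subset unfolding W_def by (rule card_mono)
  have "N ^ 2 * \<mu> ^ D \<le> (\<Sum>p\<in>U \<times> U. real (card (W p)) ^ D)"
    using card_mult_power_le_sum_power[of "U \<times> U" "\<lambda>p. real (card (W p))" \<mu> D] \<mu>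
      sum_card_common_nbrs_pairs[OF assms(1-5)] unfolding \<mu>_def N_def[symmetric] W_def cardUU by simp
  moreover have "(\<Sum>p\<in>U \<times> U. real (B p)) \<le> real (card A) * N ^ D * real c ^ 2"
  proof -
    have "(\<Sum>p\<in>U \<times> U. B p) = (\<Sum>a\<in>A. \<Sum>p\<in>U \<times> U. card (W p) ^ (D - card (\<Gamma> a)) * bad p a)"
      unfolding B_def by (rule sum.swap)
    also have "\<dots> \<le> (\<Sum>a\<in>A. card U ^ D * c ^ 2)"
    proof (rule sum_mono)
      fix a assume a: "a \<in> A"
      have "(\<Sum>p\<in>U \<times> U. card (W p) ^ (D - card (\<Gamma> a)) * bad p a)
          \<le> (\<Sum>p\<in>U \<times> U. card U ^ (D - card (\<Gamma> a)) * bad p a)"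
        using W_le by (intro sum_mono mult_right_mono power_mono) auto
      also have "\<dots> = card U ^ (D - card (\<Gamma> a)) * (\<Sum>p\<in>U \<times> U. bad p a)"
        by (rule sum_distrib_left[symmetric])
      also have "\<dots> \<le> card U ^ (D - card (\<Gamma> a)) * (card U ^ card (\<Gamma> a) * c ^ 2)"
        using sum_bad_maps_le[of U R "\<Gamma> a" c] assms(1) sym fin[OF a] unfolding bad_def W_def
        by (intro mult_left_mono) (auto simp: case_prod_beta)
      also have "\<dots> = card U ^ D * c ^ 2"
        using deg[OF a] by (simp add: mult.assoc[symmetric] power_add[symmetric])
      finally show "(\<Sum>p\<in>U \<times> U. card (W p) ^ (D - card (\<Gamma> a)) * bad p a) \<le> card U ^ D * c ^ 2" .
    qed
    also have "\<dots> = card A * card U ^ D * c ^ 2"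
      by simp
    finally have "real (\<Sum>p\<in>U \<times> U. B p) \<le> real (card A * card U ^ D * c ^ 2)"
      by (rule of_nat_mono)
    then show ?thesis
      by (simp add: N_def)
  qed
  moreover have "2 * (real (card A) * N ^ D * real c ^ 2) \<le> N ^ 2 * \<mu> ^ D / 2"
  proof -
    have "(4 * real (card A) * real c ^ 2 * k ^ (2 * D)) * N ^ D \<le> N ^ 2 * N ^ D"
      using big N unfolding N_def by (intro mult_right_mono) auto
    moreover have "\<mu> ^ D = N ^ D / k ^ (2 * D)"
      unfolding \<mu>_def by (simp add: power_divide power_mult)
    then have "N ^ D = \<mu> ^ D * k ^ (2 * D)"
      using assms(4) by simp
    ultimately have "(4 * real (card A) * real c ^ 2 * N ^ D) * k ^ (2 * D) \<le> (N ^ 2 * \<mu> ^ D) * k ^ (2 * D)"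
      by (simp add: mult_ac)
    then have "4 * real (card A) * real c ^ 2 * N ^ D \<le> N ^ 2 * \<mu> ^ D"
      using assms(4) by simp
    then show ?thesis
      by (simp add: mult_ac)
  qed
  ultimately have "N ^ 2 * (\<mu> ^ D / 2) \<le> (\<Sum>p\<in>U \<times> U. real (card (W p)) ^ D - 2 * real (B p))"
    by (simp add: sum_subtractf sum_distrib_left[symmetric])
  \<comment> \<open>A pair where the difference is at least its average yields both conclusions: the
    power is bounded below, and \<open>B p\<close> is at most half of it.\<close>
  then have "\<exists>p\<in>U \<times> U. \<mu> ^ D / 2 \<le> real (card (W p)) ^ D - 2 * real (B p)"
    using sum_strict_mono[of "U \<times> U" "\<lambda>p. real (card (W p)) ^ D - 2 * real (B p)" "\<lambda>p. \<mu> ^ D / 2"]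
      assms(1,2) cardUU by (force simp: not_le)
  then obtain p where p: "\<mu> ^ D / 2 \<le> real (card (W p)) ^ D - 2 * real (B p)"
    by blast
  \<comment> \<open>The \<open>D\<close>-th root of \<open>\<mu> ^ D / 2\<close> is replaced by the
    cruder \<open>\<mu> / 2\<close>, using \<open>1 \<le> D\<close>.\<close>
  have "(\<mu> / 2) ^ D \<le> \<mu> ^ D / 2"
    using \<mu> self_le_power[of "2::real" D] assms(9) by (simp add: power_divide field_simps)
  also have "\<dots> \<le> real (card (W p)) ^ D"
    using p by simp
  finally have "\<mu> / 2 \<le> real (card (W p))"
    using assms(9) \<mu> power_mono_iff[of "\<mu> / 2" "real (card (W p))" D] by simp
  then have 1: "real (card U) \<le> 2 * k ^ 2 * real (card (W p))"
    using assms(4) unfolding \<mu>_def N_def by (simp add: field_simps)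
  have "real (2 * B p) \<le> real (card (W p) ^ D)"
    using p zero_less_power[OF \<mu>, of D] unfolding of_nat_mult of_nat_power by linarith
  then have 2: "2 * B p \<le> card (W p) ^ D"
    by (simp only: of_nat_le_iff)
  show ?thesis
    using that[OF common_nbrs_subset] 1 2 unfolding B_def bad_def W_def by simp
qed

section \<open>Embedding a bipartite graph with bounded degrees on one side\<close>

text \<open>A map on \<open>B\<close> is determined by its restrictions to \<open>I\<close> and
  \<open>B - I\<close>. This bounds the probability of an event that depends only on the values on
  \<open>I\<close>.\<close>

lemma card_restrict_maps_le:
  assumes "finite B" and "finite W" and "I \<subseteq> B"
  shows "card {f \<in> B \<rightarrow>\<^sub>E W. P (restrict f I)} \<le> card {g \<in> I \<rightarrow>\<^sub>E W. P g} * card W ^ (card B - card I)"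
proof -
  have finI: "finite I"
    using assms finite_subset by blast
  let ?\<phi> = "\<lambda>f. (restrict f I, restrict f (B - I))"
  have "inj_on ?\<phi> {f \<in> B \<rightarrow>\<^sub>E W. P (restrict f I)}"
  proof (rule inj_onI)
    fix f f' assume f: "f \<in> {f \<in> B \<rightarrow>\<^sub>E W. P (restrict f I)}" "f' \<in> {f \<in> B \<rightarrow>\<^sub>E W. P (restrict f I)}"
      and eq: "?\<phi> f = ?\<phi> f'"
    have "f x = f' x" if "x \<in> B" for x
      using eq that by (cases "x \<in> I") (auto dest: fun_cong[of _ _ x])
    then show "f = f'"
      using f by (intro PiE_ext[of f B "\<lambda>_. W" f']) simp_all
  qed
  moreover have "?\<phi> ` {f \<in> B \<rightarrow>\<^sub>E W. P (restrict f I)} \<subseteq> {g \<in> I \<rightarrow>\<^sub>E W. P g} \<times> (B - I \<rightarrow>\<^sub>E W)"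
    using assms(3) by (auto simp: PiE_iff extensional_def inf.absorb2 subset_iff)
  ultimately have "card {f \<in> B \<rightarrow>\<^sub>E W. P (restrict f I)} \<le> card ({g \<in> I \<rightarrow>\<^sub>E W. P g} \<times> (B - I \<rightarrow>\<^sub>E W))"
    using assms finI by (intro card_inj_on_le) (auto intro!: finite_PiE finite_cartesian_product)
  also have "\<dots> = card {g \<in> I \<rightarrow>\<^sub>E W. P g} * card W ^ (card B - card I)"
    using assms finI by (simp add: card_cartesian_product card_funcsetE card_Diff_subset)
  finally show ?thesis .
qed

text \<open>The value at \<open>u\<close> is forced by the value at \<open>v\<close>, so restricting
  to \<open>B - {u}\<close> loses nothing.\<close>

lemma card_collision_maps_le:
  assumes "finite B" and "finite W" and "u \<in> B" and "v \<in> B" and "u \<noteq> v"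
  shows "card {f \<in> B \<rightarrow>\<^sub>E W. f u = f v} \<le> card W ^ (card B - 1)"
proof -
  have "inj_on (\<lambda>f. restrict f (B - {u})) {f \<in> B \<rightarrow>\<^sub>E W. f u = f v}"
  proof (rule inj_onI)
    fix f f' assume f: "f \<in> {f \<in> B \<rightarrow>\<^sub>E W. f u = f v}" "f' \<in> {f \<in> B \<rightarrow>\<^sub>E W. f u = f v}"
      and eq: "restrict f (B - {u}) = restrict f' (B - {u})"
    have "f x = f' x" if "x \<in> B - {u}" for x
      using fun_cong[OF eq, of x] that by simp
    then have "f x = f' x" if "x \<in> B" for x
      using f assms(4,5) that by (cases "x = u") auto
    then show "f = f'"
      using f by (intro PiE_ext[of f B "\<lambda>_. W" f']) simp_all
  qed
  moreover have "(\<lambda>f. restrict f (B - {u})) ` {f \<in> B \<rightarrow>\<^sub>E W. f u = f v} \<subseteq> B - {u} \<rightarrow>\<^sub>E W"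
    by (auto simp: PiE_iff extensional_def split: if_splits)
  ultimately have "card {f \<in> B \<rightarrow>\<^sub>E W. f u = f v} \<le> card (B - {u} \<rightarrow>\<^sub>E W)"
    using assms by (intro card_inj_on_le finite_PiE) auto
  then show ?thesis
    using assms by (simp add: card_funcsetE)
qed

text \<open>Union bound for a uniformly random map from \<open>B\<close> to \<open>W\<close>. By
  \<open>large\<close>, fewer than half of the maps have a collision, as at most
  \<open>card B ^ 2\<close> pairs can collide; by \<open>few\<close>, at most half are bad at some
  vertex of \<open>A\<close>. The strictness of the first bound leaves a map over.\<close>

lemma ex_injection_avoiding:
  fixes \<Gamma> :: "'a \<Rightarrow> 'c set" and P :: "'a \<Rightarrow> ('c \<Rightarrow> 'b) \<Rightarrow> bool"
  assumes "finite A" and "finite B" and "finite W" and sub: "\<And>a. a \<in> A \<Longrightarrow> \<Gamma> a \<subseteq> B"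
    and deg: "\<And>a. a \<in> A \<Longrightarrow> card (\<Gamma> a) \<le> D"
    and few: "2 * (\<Sum>a\<in>A. card W ^ (D - card (\<Gamma> a)) * card {g \<in> \<Gamma> a \<rightarrow>\<^sub>E W. P a g}) \<le> card W ^ D"
    and large: "2 * card B ^ 2 < card W"
  obtains f where "f \<in> B \<rightarrow>\<^sub>E W" and "inj_on f B" and "\<forall>a\<in>A. \<not> P a (restrict f (\<Gamma> a))"
proof -
  define w where "w = real (card W)"
  define n where "n = card B"
  have w: "0 < w"
    using large unfolding w_def by simp
  define K where "K = (\<Union>p\<in>{p \<in> B \<times> B. fst p \<noteq> snd p}. {f \<in> B \<rightarrow>\<^sub>E W. f (fst p) = f (snd p)})"
  define L where "L = (\<Union>a\<in>A. {f \<in> B \<rightarrow>\<^sub>E W. P a (restrict f (\<Gamma> a))})"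
  have finBW: "finite (B \<rightarrow>\<^sub>E W)"
    using assms by (auto intro: finite_PiE)
  have "real (card K) < w ^ n / 2"
  proof (cases "n = 0")
    case True
    then have "K = {}"
      using assms(2) unfolding n_def K_def by auto
    then show ?thesis
      using w by simp
  next
    case False
    have "card K \<le> (\<Sum>p\<in>{p \<in> B \<times> B. fst p \<noteq> snd p}. card {f \<in> B \<rightarrow>\<^sub>E W. f (fst p) = f (snd p)})"
      using assms(2) unfolding K_def by (intro card_UN_le) auto
    also have "\<dots> \<le> (\<Sum>p\<in>{p \<in> B \<times> B. fst p \<noteq> snd p}. card W ^ (n - 1))"
      using assms unfolding n_def by (intro sum_mono card_collision_maps_le) auto
    also have "\<dots> = card {p \<in> B \<times> B. fst p \<noteq> snd p} * card W ^ (n - 1)"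
      by simp
    also have "\<dots> \<le> n ^ 2 * card W ^ (n - 1)"
      using assms(2) card_mono[of "B \<times> B" "{p \<in> B \<times> B. fst p \<noteq> snd p}"]
      by (intro mult_right_mono) (auto simp: n_def card_cartesian_product power2_eq_square)
    finally have "real (card K) \<le> real (n ^ 2 * card W ^ (n - 1))"
      by (rule of_nat_mono)
    also have "\<dots> = real (n ^ 2) * w ^ (n - 1)"
      by (simp add: w_def)
    also have "\<dots> < (w / 2) * w ^ (n - 1)"
    proof (rule mult_strict_right_mono)
      have "real (2 * n ^ 2) < w"
        unfolding n_def w_def using large by (rule of_nat_less_iff[THEN iffD2])
      then show "real (n ^ 2) < w / 2"
        by simp
    qed (use w in simp)
    also have "\<dots> = w ^ n / 2"
      using False by (cases n) auto
    finally show ?thesis .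
  qed
  moreover have "real (card L) \<le> w ^ n / 2"
  proof -
    \<comment> \<open>\<open>q a\<close> is the probability that a random map on
      \<open>\<Gamma> a\<close> satisfies \<open>P a\<close>; dividing \<open>few\<close> by
      \<open>w ^ D\<close> shows that these probabilities add up to at most 1/2.\<close>
    define q where "q a = real (card {g \<in> \<Gamma> a \<rightarrow>\<^sub>E W. P a g}) / w ^ card (\<Gamma> a)" for a
    have "real (2 * (\<Sum>a\<in>A. card W ^ (D - card (\<Gamma> a)) * card {g \<in> \<Gamma> a \<rightarrow>\<^sub>E W. P a g})) \<le> real (card W ^ D)"
      using few by (rule of_nat_mono)
    also have "real (2 * (\<Sum>a\<in>A. card W ^ (D - card (\<Gamma> a)) * card {g \<in> \<Gamma> a \<rightarrow>\<^sub>E W. P a g}))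
        = 2 * (\<Sum>a\<in>A. w ^ D * q a)"
      using deg w by (auto simp: w_def[symmetric] q_def power_diff intro!: sum.cong)
    also have "\<dots> = w ^ D * (2 * sum q A)"
      by (simp add: sum_distrib_left[symmetric])
    finally have q: "2 * sum q A \<le> 1"
      using w by (simp add: w_def)
    have "card L \<le> (\<Sum>a\<in>A. card {f \<in> B \<rightarrow>\<^sub>E W. P a (restrict f (\<Gamma> a))})"
      using assms(1) unfolding L_def by (rule card_UN_le)
    also have "\<dots> \<le> (\<Sum>a\<in>A. card {g \<in> \<Gamma> a \<rightarrow>\<^sub>E W. P a g} * card W ^ (card B - card (\<Gamma> a)))"
      using assms by (intro sum_mono card_restrict_maps_le) auto
    finally have "real (card L) \<le> real (\<Sum>a\<in>A. card {g \<in> \<Gamma> a \<rightarrow>\<^sub>E W. P a g} * card W ^ (card B - card (\<Gamma> a)))"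
      by (rule of_nat_mono)
    also have "\<dots> = (\<Sum>a\<in>A. w ^ n * q a)"
      using card_mono[OF assms(2) sub] w by (auto simp: w_def[symmetric] q_def n_def power_diff intro!: sum.cong)
    also have "\<dots> = w ^ n * sum q A"
      by (simp add: sum_distrib_left)
    also have "\<dots> \<le> w ^ n * (1 / 2)"
      using q w by (intro mult_left_mono) auto
    finally show ?thesis
      by simp
  qed
  ultimately have "real (card (K \<union> L)) < w ^ n"
    using card_Un_le[of K L] by linarith
  also have "w ^ n = real (card (B \<rightarrow>\<^sub>E W))"
    using assms by (simp add: w_def n_def card_funcsetE)
  finally have "card (K \<union> L) < card (B \<rightarrow>\<^sub>E W)"
    by simp
  moreover have "finite (K \<union> L)"
    using finBW unfolding K_def L_def by (rule rev_finite_subset) auto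
  ultimately obtain f where "f \<in> B \<rightarrow>\<^sub>E W" "f \<notin> K" "f \<notin> L"
    by (metis card_mono not_le subsetI UnI1 UnI2)
  moreover then have "inj_on f B"
    unfolding K_def by (fastforce intro: inj_onI)
  ultimately show ?thesis
    using that unfolding L_def by blast
qed

text \<open>Greedy choice: when the next representative is picked, fewer than \<open>card A\<close>
  values are taken.\<close>

lemma ex_distinct_representatives:
  assumes "finite A" and "\<And>a. a \<in> A \<Longrightarrow> card A \<le> card (S a)"
  obtains g where "inj_on g A" and "\<forall>a\<in>A. g a \<in> S a"
proof -
  have "\<exists>g. inj_on g A \<and> (\<forall>a\<in>A. g a \<in> S a)"
    using assms
  proof (induction A rule: finite_induct)
    case empty
    then show ?case by simp
  next
    case (insert a A)
    then obtain g where g: "inj_on g A" "\<forall>a\<in>A. g a \<in> S a"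
      by (metis card_insert_disjoint insertCI Suc_leD)
    have "card (g ` A) < card (S a)"
      using insert card_image_le[of A g] by (metis card_insert_disjoint insertI1 le_imp_less_Suc order_less_le_trans)
    then obtain y where "y \<in> S a" "y \<notin> g ` A"
      using insert(1) by (metis card_mono finite_imageI not_le subsetI)
    moreover have "(g(a := y)) ` A = g ` A"
      using insert(2) by auto
    moreover have "inj_on (g(a := y)) A"
      using g(1) insert(2) by (simp add: inj_on_def)
    ultimately show ?case
      using g(2) insert(2) by (intro exI[of _ "g(a := y)"]) (simp add: inj_on_insert del: fun_upd_apply, simp)
  qed
  then show ?thesis
    using that by blast
qed

text \<open>The relation \<open>R\<close> may be reflexive: \<open>A\<close> and \<open>B\<close> are mapped to disjoint sets, so loops are
  never used, and allowing them makes the density of a colour class exactly \<open>1 / k\<close>.\<close>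

lemma bipartite_embedding:
  fixes R :: "'b \<Rightarrow> 'b \<Rightarrow> bool" and k :: real and \<Gamma> :: "'a \<Rightarrow> 'c set"
  assumes "finite U" and "U \<noteq> {}" and "\<And>x y. R x y \<Longrightarrow> R y x" and "0 < k"
    and "real (card U) ^ 2 \<le> k * (\<Sum>x\<in>U. real (card (common_nbrs R U {x})))"
    and "finite A" and "finite B" and sub: "\<And>a. a \<in> A \<Longrightarrow> \<Gamma> a \<subseteq> B"
    and deg: "\<And>a. a \<in> A \<Longrightarrow> card (\<Gamma> a) \<le> D" and "1 \<le> D"
    and "card A \<le> m" and "card B \<le> m"
    and "16 * real m ^ 3 * k ^ (2 * D) \<le> real (card U) ^ 2"
    and large: "4 * k ^ 2 * real m ^ 2 < real (card U)"
  obtains f g where "f ` B \<subseteq> U" and "g ` A \<subseteq> U" and "inj_on f B" and "inj_on g A"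
    and "f ` B \<inter> g ` A = {}" and "\<And>a b. a \<in> A \<Longrightarrow> b \<in> \<Gamma> a \<Longrightarrow> R (f b) (g a)"
proof -
  \<comment> \<open>At most \<open>m\<close> common neighbours are occupied by the image of
    \<open>B\<close>, which leaves at least \<open>m\<close> for choosing distinct images of the
    vertices of \<open>A\<close>.\<close>
  let ?c = "2 * m"
  have "4 * real (card A) * real ?c ^ 2 * k ^ (2 * D) \<le> 4 * real m * real ?c ^ 2 * k ^ (2 * D)"
    using assms(4,11) by (intro mult_right_mono) auto
  also have "\<dots> = 16 * real m ^ 3 * k ^ (2 * D)"
    by (simp add: power2_eq_square power3_eq_cube)
  finally have big: "4 * real (card A) * real ?c ^ 2 * k ^ (2 * D) \<le> real (card U) ^ 2"
    using assms(13) by simp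
  have fin: "finite (\<Gamma> a)" if "a \<in> A" for a
    using sub[OF that] assms(7) by (rule finite_subset)
  obtain W where W: "W \<subseteq> U" "real (card U) \<le> 2 * k ^ 2 * real (card W)"
    "2 * (\<Sum>a\<in>A. card W ^ (D - card (\<Gamma> a))
      * card {g \<in> \<Gamma> a \<rightarrow>\<^sub>E W. card (common_nbrs R U (g ` \<Gamma> a)) < ?c}) \<le> card W ^ D"
    by (rule dependent_random_choice[OF assms(1-6) fin deg assms(10) big])
  have "2 * k ^ 2 * (2 * real m ^ 2) = 4 * k ^ 2 * real m ^ 2"
    by simp
  then have "2 * k ^ 2 * (2 * real m ^ 2) < 2 * k ^ 2 * real (card W)"
    using W(2) large by linarith
  then have "2 * real m ^ 2 < real (card W)"
    using assms(4) by (simp add: mult_less_cancel_left_pos)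
  moreover have "real (card B) ^ 2 \<le> real m ^ 2"
    using assms(12) by (intro power_mono) auto
  ultimately have "real (2 * card B ^ 2) < real (card W)"
    unfolding of_nat_mult of_nat_power of_nat_numeral by linarith
  then have largeW: "2 * card B ^ 2 < card W"
    by (simp only: of_nat_less_iff)
  obtain f where f: "f \<in> B \<rightarrow>\<^sub>E W" "inj_on f B"
    "\<forall>a\<in>A. \<not> card (common_nbrs R U (restrict f (\<Gamma> a) ` \<Gamma> a)) < ?c"
    by (rule ex_injection_avoiding[OF assms(6,7) finite_subset[OF W(1) assms(1)] sub deg W(3) largeW])
  have reps: "card A \<le> card (common_nbrs R U (f ` \<Gamma> a) - f ` B)" if "a \<in> A" for a
  proof -
    have "card (common_nbrs R U (f ` \<Gamma> a)) - card (f ` B) \<le> card (common_nbrs R U (f ` \<Gamma> a) - f ` B)"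
      using assms(7) by (intro diff_card_le_card_Diff) auto
    moreover have "card (f ` B) \<le> m"
      using card_image_le[OF assms(7), of f] assms(12) by simp
    moreover have "2 * m \<le> card (common_nbrs R U (f ` \<Gamma> a))"
      using f(3) that by auto
    ultimately show ?thesis
      using assms(11) by linarith
  qed
  obtain g where g: "inj_on g A" "\<forall>a\<in>A. g a \<in> common_nbrs R U (f ` \<Gamma> a) - f ` B"
    by (rule ex_distinct_representatives[OF assms(6) reps])
  show ?thesis
  proof (rule that[OF _ _ f(2) g(1)])
    show "f ` B \<subseteq> U"
      using f(1) W(1) by auto
    show "g ` A \<subseteq> U"
      using g(2) by (auto simp: common_nbrs_def)
    have "g a \<notin> f ` B" if "a \<in> A" for a
      using bspec[OF g(2) that] by simp
    then have "\<forall>y\<in>g ` A. y \<notin> f ` B"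
      by simp
    then show "f ` B \<inter> g ` A = {}"
      by blast
    show "R (f b) (g a)" if "a \<in> A" "b \<in> \<Gamma> a" for a b
      using bspec[OF g(2) that(1)] that(2) by (auto simp: common_nbrs_def)
  qed
qed

section \<open>Dense colours and vertices joined to a set in one colour\<close>

text \<open>The vertex \<open>v\<close> is excluded because \<open>{v, v}\<close> is not an edge and
  its colour is arbitrary.\<close>

definition color_nbrs :: "('b set \<Rightarrow> nat) \<Rightarrow> 'b set \<Rightarrow> nat \<Rightarrow> 'b \<Rightarrow> 'b set" where
  "color_nbrs c U j v = {u \<in> U. u \<noteq> v \<and> c {v, u} = j}"

lemma sum_card_color_nbrs:
  assumes "finite U" and "c \<in> [U]\<^bsup>2\<^esup> \<rightarrow> {..<k}" and "v \<in> U"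
  shows "(\<Sum>j<k. card (color_nbrs c U j v)) = card U - 1"
proof -
  have "(\<Sum>j<k. card (color_nbrs c U j v)) = card (\<Union>j<k. color_nbrs c U j v)"
    using assms(1) by (intro card_UN_disjoint[symmetric]) (auto simp: color_nbrs_def)
  also have "(\<Union>j<k. color_nbrs c U j v) = U - {v}"
    using assms(2,3) by (auto simp: color_nbrs_def Pi_iff doubleton_in_nsets_2)
  finally show ?thesis
    using assms by simp
qed

text \<open>At each vertex the \<open>k\<close> colour degrees have mean
  \<open>(card U - 1) / k\<close>. The colours outside \<open>S\<close> are below this mean, so
  those in \<open>S\<close> reach it on average, and \<open>S\<close> cannot be empty. Summing over
  the vertices, some single colour of \<open>S\<close> reaches it on average over
  \<open>U\<close>.\<close>

lemma ex_dense_color: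
  assumes "finite U" and "U \<noteq> {}" and c: "c \<in> [U]\<^bsup>2\<^esup> \<rightarrow> {..<k}" and "0 < k"
    and sparse: "\<And>v j. v \<in> U \<Longrightarrow> j < k \<Longrightarrow> j \<notin> S \<Longrightarrow> k * card (color_nbrs c U j v) < card U - 1"
    and "S \<subseteq> {..<k}"
  obtains i where "i \<in> S" and "card U * (card U - 1) \<le> k * (\<Sum>v\<in>U. card (color_nbrs c U i v))"
proof -
  let ?d = "\<lambda>v j. k * card (color_nbrs c U j v)"
  have total: "(\<Sum>j<k. ?d v j) = k * (card U - 1)" if "v \<in> U" for v
    using sum_card_color_nbrs[OF assms(1) c that] by (simp add: sum_distrib_left[symmetric])
  have finS: "finite S"
    using assms(6) finite_subset by blast
  have "S \<noteq> {}"
  proof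
    assume "S = {}"
    obtain v where v: "v \<in> U"
      using assms(2) by blast
    have "(\<Sum>j<k. ?d v j) < (\<Sum>j<k. card U - 1)"
      using sparse[OF v] \<open>S = {}\<close> assms(4) by (intro sum_strict_mono) auto
    then show False
      using total[OF v] by simp
  qed
  have each: "card S * (card U - 1) \<le> (\<Sum>i\<in>S. ?d v i)" if v: "v \<in> U" for v
  proof -
    have "(\<Sum>j\<in>{..<k} - S. ?d v j) \<le> (\<Sum>j\<in>{..<k} - S. card U - 1)"
      using sparse[OF v] by (intro sum_mono) (auto intro: less_imp_le)
    also have "\<dots> + (\<Sum>i\<in>S. card U - 1) = (\<Sum>j<k. card U - 1)"
      using assms(6) by (intro sum.subset_diff[symmetric]) auto
    moreover have "(\<Sum>j\<in>{..<k} - S. ?d v j) + (\<Sum>i\<in>S. ?d v i) = (\<Sum>j<k. ?d v j)"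
      using assms(6) by (intro sum.subset_diff[symmetric]) auto
    ultimately have "(\<Sum>i\<in>S. card U - 1) \<le> (\<Sum>i\<in>S. ?d v i)"
      using total[OF v] by simp
    then show ?thesis
      by simp
  qed
  have "\<exists>i\<in>S. card U * (card U - 1) \<le> k * (\<Sum>v\<in>U. card (color_nbrs c U i v))"
  proof (rule ccontr)
    assume "\<not> ?thesis"
    then have "(\<Sum>i\<in>S. k * (\<Sum>v\<in>U. card (color_nbrs c U i v))) < (\<Sum>i\<in>S. card U * (card U - 1))"
      using \<open>S \<noteq> {}\<close> finS by (intro sum_strict_mono) auto
    also have "\<dots> = (\<Sum>v\<in>U. card S * (card U - 1))"
      by simp
    also have "\<dots> \<le> (\<Sum>v\<in>U. \<Sum>i\<in>S. ?d v i)"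
      using each by (rule sum_mono)
    also have "\<dots> = (\<Sum>i\<in>S. \<Sum>v\<in>U. ?d v i)"
      by (rule sum.swap)
    finally show False
      by (simp add: sum_distrib_left)
  qed
  then show ?thesis
    using that by blast
qed

text \<open>The set \<open>T j\<close> collects vertices joined to all of \<open>U\<close> in colour \<open>j\<close>. As long as a colour with
  \<open>card (T j) < t\<close> has a vertex of large degree, that vertex is moved to \<open>T j\<close>; otherwise the
  edges inside \<open>U\<close> are mostly of colours whose \<open>T j\<close> is already full.\<close>

lemma ex_dense_color_with_apexes:
  fixes c :: "'b set \<Rightarrow> nat"
  assumes "finite Z" and c: "c \<in> [Z]\<^bsup>2\<^esup> \<rightarrow> {..<k}" and "2 \<le> k" and "U \<subseteq> Z"
    and "\<And>j. j < k \<Longrightarrow> T j \<subseteq> Z \<and> T j \<inter> U = {} \<and> card (T j) \<le> t \<and> (\<forall>v\<in>T j. \<forall>u\<in>U. c {v, u} = j)"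
    and "(\<Sum>j<k. t - card (T j)) = p" and "k ^ p < card U + 1"
  shows "\<exists>U' i T'. U' \<subseteq> U \<and> U' \<noteq> {} \<and> T' \<subseteq> Z \<and> T' \<inter> U' = {} \<and> card T' = t \<and>
    (\<forall>v\<in>T'. \<forall>u\<in>U'. c {v, u} = i) \<and>
    card U' * (card U' - 1) \<le> k * (\<Sum>v\<in>U'. card (color_nbrs c U' i v)) \<and>
    card U + 1 \<le> k ^ p * (card U' + 1)"
  using assms(4-7)
\<comment> \<open>\<open>p\<close> counts the free places in all sets \<open>T j\<close> together.
  Each move fills one of them and costs one factor \<open>k\<close> in the size of
  \<open>U\<close>.\<close>
proof (induction p arbitrary: U T rule: less_induct)
  case (less p)
  note TU = less.prems(2)
  have finU: "finite U"
    using less.prems(1) assms(1) finite_subset by blast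
  have "1 \<le> k ^ p"
    using assms(3) by simp
  then have U: "U \<noteq> {}"
    using less.prems(4) by (metis add_0 card.empty not_le)
  show ?case
  proof (cases "\<exists>v\<in>U. \<exists>j<k. card (T j) < t \<and> card U - 1 \<le> k * card (color_nbrs c U j v)")
    case True
    then obtain v j where vj: "v \<in> U" "j < k" "card (T j) < t" "card U - 1 \<le> k * card (color_nbrs c U j v)"
      by blast
    define U1 where "U1 = color_nbrs c U j v"
    define T1 where "T1 = T(j := insert v (T j))"
    have U1: "U1 \<subseteq> U" "v \<notin> U1"
      unfolding U1_def color_nbrs_def by auto
    have "finite (T j)"
      using TU[OF vj(2)] assms(1) finite_subset by blast
    then have card_T1: "card (insert v (T j)) = Suc (card (T j))"
      using TU[OF vj(2)] vj(1) by (intro card_insert_disjoint) auto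
    have "(\<Sum>i<k. t - card (T i)) = (t - card (T j)) + (\<Sum>i\<in>{..<k} - {j}. t - card (T i))"
      using vj(2) by (intro sum.remove) auto
    moreover have "(\<Sum>i<k. t - card (T1 i)) = (t - card (T1 j)) + (\<Sum>i\<in>{..<k} - {j}. t - card (T1 i))"
      using vj(2) by (intro sum.remove) auto
    moreover have "(\<Sum>i\<in>{..<k} - {j}. t - card (T1 i)) = (\<Sum>i\<in>{..<k} - {j}. t - card (T i))"
      unfolding T1_def by (intro sum.cong) auto
    ultimately obtain q where q: "p = Suc q" "(\<Sum>i<k. t - card (T1 i)) = q"
      using less.prems(3) vj(3) card_T1 unfolding T1_def by (cases p) (auto simp: Suc_diff_Suc)
    \<comment> \<open>Measuring \<open>U\<close> by \<open>card U + 1\<close> absorbs the loss of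
      \<open>v\<close>: thanks to \<open>2 \<le> k\<close>, the bound on \<open>card U - 1\<close>
      becomes a clean factor \<open>k\<close>, which can be iterated.\<close>
    have "card U + 1 \<le> k * card U1 + 2"
      using vj(4) unfolding U1_def by linarith
    also have "\<dots> \<le> k * (card U1 + 1)"
      using assms(3) by simp
    finally have step: "card U + 1 \<le> k * (card U1 + 1)" .
    then have "k * k ^ q < k * (card U1 + 1)"
      using less.prems(4) q(1) by simp
    then have "k ^ q < card U1 + 1"
      by (simp only: mult_less_cancel1)
    note lt = this
    have "T1 i \<subseteq> Z \<and> T1 i \<inter> U1 = {} \<and> card (T1 i) \<le> t \<and> (\<forall>v\<in>T1 i. \<forall>u\<in>U1. c {v, u} = i)"
      if "i < k" for i
    proof (cases "i = j")
      case True
      moreover have "c {v, u} = j" if "u \<in> U1" for u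
        using that unfolding U1_def color_nbrs_def by auto
      ultimately show ?thesis
        using TU[OF vj(2)] U1 vj(1,3) card_T1 less.prems(1) unfolding T1_def by auto
    next
      case False
      then show ?thesis
        using TU[OF that] U1 unfolding T1_def by auto
    qed
    note T1 = this
    obtain U' i T' where *: "U' \<subseteq> U1" "U' \<noteq> {}" "T' \<subseteq> Z" "T' \<inter> U' = {}" "card T' = t"
      "\<forall>v\<in>T'. \<forall>u\<in>U'. c {v, u} = i"
      "card U' * (card U' - 1) \<le> k * (\<Sum>v\<in>U'. card (color_nbrs c U' i v))"
      "card U1 + 1 \<le> k ^ q * (card U' + 1)"
      using less.IH[OF _ subset_trans[OF U1(1) less.prems(1)] T1 q(2) lt] q(1) by auto
    have "card U + 1 \<le> k * (k ^ q * (card U' + 1))"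
      using step mult_le_mono2[OF *(8), of k] by (rule le_trans)
    then have "card U + 1 \<le> k ^ p * (card U' + 1)"
      by (simp only: q(1) power_Suc mult.assoc)
    moreover have "U' \<subseteq> U"
      using *(1) U1(1) by (rule subset_trans)
    ultimately show ?thesis
      using *(2-7) by (intro exI[of _ U'] exI[of _ i] exI[of _ T'] conjI)
  next
    case False
    define S where "S = {j. j < k \<and> card (T j) = t}"
    have cU: "c \<in> [U]\<^bsup>2\<^esup> \<rightarrow> {..<k}"
      using c nsets_mono[OF less.prems(1)] by (auto simp: Pi_iff)
    have sparse: "k * card (color_nbrs c U j v) < card U - 1" if "v \<in> U" "j < k" "j \<notin> S" for v j
    proof -
      have "card (T j) < t"
        using TU[OF that(2)] that(2,3) unfolding S_def by (simp add: le_neq_implies_less)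
      then show ?thesis
        using False that(1,2) by (meson not_le)
    qed
    have "0 < k" and sub: "S \<subseteq> {..<k}"
      using assms(3) unfolding S_def by auto
    obtain i where "i \<in> S" and i: "card U * (card U - 1) \<le> k * (\<Sum>v\<in>U. card (color_nbrs c U i v))"
      by (rule ex_dense_color[OF finU U cU \<open>0 < k\<close> sparse sub])
    have "i < k" "card (T i) = t"
      using \<open>i \<in> S\<close> unfolding S_def by auto
    have "1 * (card U + 1) \<le> k ^ p * (card U + 1)"
      using \<open>1 \<le> k ^ p\<close> by (rule mult_le_mono1)
    then show ?thesis
      using TU[OF \<open>i < k\<close>] i U \<open>card (T i) = t\<close>
      by (intro exI[of _ U] exI[of _ i] exI[of _ "T i"] conjI) auto
  qed
qed

section \<open>Assembling the monochromatic copy\<close>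

text \<open>The copy consists of exactly the images of the edges, so non-edges of \<open>E\<close>
  put no condition on \<open>c\<close>. Injectivity on \<open>V\<close> ensures that no further pair
  is mapped onto an edge of the copy.\<close>

lemma monochromatic_copyI:
  assumes "simple_graph V E" and inj: "inj_on \<phi> V" and "\<phi> ` V \<subseteq> {..<n}"
    and mono: "\<And>x y. {x, y} \<in> E \<Longrightarrow> c {\<phi> x, \<phi> y} = i"
  shows "monochromatic_copy n c V E"
proof -
  define D where "D = (`) \<phi> ` E"
  have EV: "E \<subseteq> [V]\<^bsup>2\<^esup>" and fin: "finite V"
    using assms(1) by (auto simp: simple_graph_def)
  have "D \<subseteq> (`) \<phi> ` ([V]\<^bsup>2\<^esup>)"
    unfolding D_def using EV by (rule image_mono)
  also have "\<dots> = [\<phi> ` V]\<^bsup>2\<^esup>"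
    using bij_betw_nsets[OF inj_on_imp_bij_betw[OF inj]] by (rule bij_betw_imp_surj_on)
  finally have D: "D \<subseteq> [\<phi> ` V]\<^bsup>2\<^esup>" .
  then have "subgraph (\<phi> ` V) D {..<n} ([{..<n}]\<^bsup>2\<^esup>)"
    using fin assms(3) nsets_mono[OF assms(3), of 2] unfolding subgraph_def simple_graph_def by auto
  moreover have "{x, y} \<in> E \<longleftrightarrow> {\<phi> x, \<phi> y} \<in> D" if "x \<in> V" "y \<in> V" for x y
  proof
    assume "{\<phi> x, \<phi> y} \<in> D"
    then obtain e where e: "e \<in> E" "\<phi> ` {x, y} = \<phi> ` e"
      unfolding D_def by auto
    moreover have "e \<subseteq> V" "{x, y} \<subseteq> V"
      using e(1) EV that by (auto simp: nsets_def)
    ultimately show "{x, y} \<in> E"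
      using inj_on_image_eq_iff[OF inj] by metis
  qed (auto simp: D_def intro: image_eqI[of _ _ "{x, y}"])
  then have "graph_isomorphic V E (\<phi> ` V) D"
    using inj unfolding graph_isomorphic_def by (intro exI[of _ \<phi>]) (simp add: inj_on_imp_bij_betw)
  moreover have "c d = i" if d: "d \<in> D" for d
  proof -
    obtain e where e: "e \<in> E" "d = \<phi> ` e"
      using d unfolding D_def by blast
    moreover obtain x y where "e = {x, y}"
      using e(1) EV by (blast elim: nsets2_E)
    ultimately show ?thesis
      using mono by simp
  qed
  ultimately show ?thesis
    unfolding monochromatic_copy_def by blast
qed

text \<open>The \<open>t\<close> vertices of \<open>A\<close> of degree above \<open>D\<close> go to
  a set joined to all of \<open>U\<close> in colour \<open>i\<close>, the remaining vertices go into
  \<open>U\<close>. Edges at high-degree vertices get colour \<open>i\<close> since \<open>B\<close>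
  lands in \<open>U\<close>; the others get it from the bounded-degree embedding. The size of
  \<open>U\<close> is known only through the factor lost on the way, hence the form of
  \<open>large\<close>.\<close>

lemma ramsey_property_bipartite:
  fixes V :: "'a set" and k m n D :: nat
  defines "\<Gamma> \<equiv> \<lambda>E (B :: 'a set) a. {b \<in> B. {a, b} \<in> E}"
  assumes graph: "simple_graph V E" and V: "V = A \<union> B" and disj: "A \<inter> B = {}"
    and edges: "\<And>e. e \<in> E \<Longrightarrow> \<exists>a\<in>A. \<exists>b\<in>B. e = {a, b}"
    and "card A \<le> m" and "card B \<le> m" and "2 \<le> k" and "1 \<le> D"
    and t: "t = card {a \<in> A. D < card (\<Gamma> E B a)}"
    and n: "k ^ (k * t) < n + 1"
    and large: "\<And>N. n + 1 \<le> k ^ (k * t) * (N + 1) \<Longrightarrow>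
      16 * real m ^ 3 * real k ^ (2 * D) \<le> real N ^ 2 \<and> 4 * real k ^ 2 * real m ^ 2 < real N"
  shows "ramsey_property k V E n"
  unfolding ramsey_property_def
proof
  fix c assume c: "c \<in> [{..<n}]\<^bsup>2\<^esup> \<rightarrow> {..<k}"
  define T where "T = {a \<in> A. D < card (\<Gamma> E B a)}"
  have fin: "finite A" "finite B"
    using graph V by (auto simp: simple_graph_def)
  obtain U i T' where U: "U \<subseteq> {..<n}" "U \<noteq> {}" "T' \<subseteq> {..<n}" "T' \<inter> U = {}" "card T' = t"
    "\<forall>v\<in>T'. \<forall>u\<in>U. c {v, u} = i"
    "card U * (card U - 1) \<le> k * (\<Sum>v\<in>U. card (color_nbrs c U i v))"
    "n + 1 \<le> k ^ (k * t) * (card U + 1)"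
    \<comment> \<open>Starting from empty sets \<open>T j\<close>, there are \<open>k * t\<close>
      places to fill.\<close>
    using ex_dense_color_with_apexes[of "{..<n}" c k "{..<n}" "\<lambda>_. {}" t "k * t"] c n assms(8) by auto
  have finU: "finite U"
    using U(1) finite_subset by blast
  define R where "R x y \<longleftrightarrow> x = y \<or> c {x, y} = i" for x y
  have "common_nbrs R U {x} = insert x (color_nbrs c U i x)" if "x \<in> U" for x
    using that by (auto simp: common_nbrs_def R_def color_nbrs_def insert_commute)
  then have deg: "card (common_nbrs R U {x}) = card (color_nbrs c U i x) + 1" if "x \<in> U" for x
    using that finU by (simp add: color_nbrs_def)
  \<comment> \<open>The loops in \<open>R\<close> raise every degree by one; this pays for the gap
    between \<open>card U * (card U - 1)\<close> and \<open>card U ^ 2\<close>.\<close>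
  have "card U ^ 2 = card U * (card U - 1) + card U"
    using U(2) finU by (cases "card U") (auto simp: power2_eq_square)
  also have "\<dots> \<le> k * (\<Sum>v\<in>U. card (color_nbrs c U i v)) + k * card U"
    using U(7) assms(8) by (intro add_mono) auto
  also have "\<dots> = k * (\<Sum>x\<in>U. card (common_nbrs R U {x}))"
  proof -
    have "(\<Sum>x\<in>U. card (common_nbrs R U {x})) = (\<Sum>v\<in>U. card (color_nbrs c U i v) + 1)"
      using deg by (rule sum.cong[OF refl])
    then show ?thesis
      by (simp only: sum.distrib) (simp add: distrib_left)
  qed
  finally have "real (card U ^ 2) \<le> real (k * (\<Sum>x\<in>U. card (common_nbrs R U {x})))"
    by (rule of_nat_mono)
  then have dens: "real (card U) ^ 2 \<le> real k * (\<Sum>x\<in>U. real (card (common_nbrs R U {x})))"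
    by simp
  have sym: "R y x" if "R x y" for x y
    using that by (auto simp: R_def insert_commute)
  have "card (A - T) \<le> card A"
    using fin(1) by (intro card_mono) auto
  then have cardAT: "card (A - T) \<le> m"
    using assms(6) by simp
  obtain f g where fg: "f ` B \<subseteq> U" "g ` (A - T) \<subseteq> U" "inj_on f B" "inj_on g (A - T)"
    "f ` B \<inter> g ` (A - T) = {}" "\<And>a b. a \<in> A - T \<Longrightarrow> b \<in> \<Gamma> E B a \<Longrightarrow> R (f b) (g a)"
  proof (rule bipartite_embedding[OF finU U(2) sym _ dens finite_Diff[OF fin(1)] fin(2), where \<Gamma> = "\<Gamma> E B" and D = D])
    show "card (\<Gamma> E B a) \<le> D" if "a \<in> A - T" for a
      using that unfolding T_def by auto
  qed (use assms(8,9) cardAT assms(7) large[OF U(8)] in \<open>auto simp: \<Gamma>_def\<close>)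
  have "finite T" "finite T'"
    using fin U(3) finite_subset unfolding T_def by auto
  then obtain h where h: "bij_betw h T T'"
    using t U(5) finite_same_card_bij unfolding T_def by metis
  define \<phi> where "\<phi> x = (if x \<in> T then h x else if x \<in> A then g x else f x)" for x
  have TA: "T \<subseteq> A"
    unfolding T_def by auto
  have hT: "h ` T = T'" "inj_on h T"
    using h by (auto simp: bij_betw_def)
  show "monochromatic_copy n c V E"
  proof (rule monochromatic_copyI[OF graph])
    have \<phi>: "\<And>x. x \<in> T \<Longrightarrow> \<phi> x = h x" "\<And>x. x \<in> A - T \<Longrightarrow> \<phi> x = g x" "\<And>x. x \<in> B \<Longrightarrow> \<phi> x = f x"
      using disj TA by (auto simp: \<phi>_def)
    then have im: "\<phi> ` T = T'" "\<phi> ` (A - T) = g ` (A - T)" "\<phi> ` B = f ` B"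
      using image_cong[OF refl, of T \<phi> h] image_cong[OF refl, of "A - T" \<phi> g]
        image_cong[OF refl, of B \<phi> f] hT(1) by simp_all
    have inj: "inj_on \<phi> T" "inj_on \<phi> (A - T)" "inj_on \<phi> B"
      using inj_on_cong[of T \<phi> h, OF \<phi>(1)] inj_on_cong[of "A - T" \<phi> g, OF \<phi>(2)]
        inj_on_cong[of B \<phi> f, OF \<phi>(3)] hT(2) fg(3,4) by blast+
    have "\<phi> ` (A - T) \<inter> \<phi> ` B = {}"
      using fg(5) im(2,3) by (simp add: Int_commute)
    then have "inj_on \<phi> (A - T \<union> B)"
      using inj(2,3) unfolding inj_on_Un by blast
    moreover have "\<phi> ` (A - T \<union> B) \<subseteq> U"
      unfolding image_Un im using fg(1,2) by simp
    then have "\<phi> ` T \<inter> \<phi> ` (A - T \<union> B) = {}"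
      using U(4) im(1) by blast
    ultimately have "inj_on \<phi> (T \<union> (A - T \<union> B))"
      using inj(1) unfolding inj_on_Un[of \<phi> T] by blast
    moreover have "V = T \<union> (A - T \<union> B)"
      using V TA by auto
    ultimately show "inj_on \<phi> V" "\<phi> ` V \<subseteq> {..<n}"
      using im U(1,3) fg(1,2) by (auto simp: image_Un)
    show "c {\<phi> x, \<phi> y} = i" if xy: "{x, y} \<in> E" for x y
    proof -
      obtain a b where ab: "a \<in> A" "b \<in> B" "{x, y} = {a, b}"
        using edges[OF xy] by blast
      have b: "\<phi> b = f b" "f b \<in> U"
        using ab(2) disj TA fg(1) by (auto simp: \<phi>_def)
      have "c {\<phi> a, \<phi> b} = i"
      proof (cases "a \<in> T")
        case True
        then show ?thesis
          using b U(6) hT(1) by (auto simp: \<phi>_def)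
      next
        case False
        then have "R (f b) (g a)"
          using fg(6)[of a b] ab xy by (simp add: \<Gamma>_def)
        \<comment> \<open>The images of \<open>B\<close> and \<open>A - T\<close> are disjoint, so
          \<open>R\<close> does not hold by reflexivity here and gives the colour.\<close>
        moreover have "f b \<noteq> g a"
          using fg(5) False ab by auto
        ultimately show ?thesis
          using False ab b by (simp add: \<phi>_def R_def insert_commute)
      qed
      moreover have "{\<phi> x, \<phi> y} = {\<phi> a, \<phi> b}"
        using arg_cong[OF ab(3), of "\<lambda>S. \<phi> ` S"] by simp
      ultimately show ?thesis
        by simp
    qed
  qed
qed

section \<open>Edge counts and numerical estimates\<close>

text \<open>Choosing an incident edge for each vertex of \<open>A\<close> is injective, because an
  edge contains only one vertex of \<open>A\<close>.\<close>

lemma card_part_le_card_edges: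
  assumes "finite E" and "A \<inter> B = {}" and edges: "\<And>e. e \<in> E \<Longrightarrow> \<exists>a\<in>A. \<exists>b\<in>B. e = {a, b}"
    and iso: "\<And>v. v \<in> A \<Longrightarrow> \<not> isolated E v"
  shows "card A \<le> card E"
proof -
  obtain s where s: "\<And>v. v \<in> A \<Longrightarrow> s v \<in> E \<and> v \<in> s v"
    using iso unfolding isolated_def by metis
  have "inj_on s A"
  proof (rule inj_onI)
    fix u v assume uv: "u \<in> A" "v \<in> A" "s u = s v"
    then obtain a b where "b \<in> B" "s u = {a, b}"
      using s edges by metis
    then show "u = v"
      using s[OF uv(1)] s[OF uv(2)] uv assms(2) by auto
  qed
  then show ?thesis
    using s assms(1) by (intro card_inj_on_le) auto
qed

text \<open>An edge between \<open>A\<close> and \<open>B\<close> determines its endpoint in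
  \<open>A\<close>, so the edges at distinct high-degree vertices are distinct.\<close>

lemma card_high_degree_le:
  fixes E :: "'a set set"
  assumes "finite E" and "finite A" and "finite B" and "A \<inter> B = {}"
  shows "card {a \<in> A. D < card {b \<in> B. {a, b} \<in> E}} * (D + 1) \<le> card E"
proof -
  let ?T = "{a \<in> A. D < card {b \<in> B. {a, b} \<in> E}}"
  have "card ?T * (D + 1) = (\<Sum>a\<in>?T. D + 1)"
    by simp
  also have "\<dots> \<le> (\<Sum>a\<in>?T. card {b \<in> B. {a, b} \<in> E})"
    by (rule sum_mono) auto
  also have "\<dots> = card (SIGMA a:?T. {b \<in> B. {a, b} \<in> E})"
    using assms by simp
  also have "\<dots> \<le> card E"
  proof (rule card_inj_on_le)
    show "inj_on (\<lambda>(a, b). {a, b}) (SIGMA a:?T. {b \<in> B. {a, b} \<in> E})"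
      using assms(4) by (auto simp: inj_on_def doubleton_eq_iff)
  qed (use assms(1) in auto)
  finally show ?thesis .
qed

text \<open>With \<open>q = k powr s\<close>, the bound is \<open>X = 64 * m * s * q * q\<close>.
  One factor \<open>q\<close> pays for \<open>k ^ (k * t)\<close>, leaving \<open>N\<close> above
  \<open>63 * m * s * q\<close>. Squaring this and using \<open>s ^ 2 = k * m\<close> and
  \<open>k ^ D \<le> q\<close> gives the first size condition; the second follows from
  \<open>k * s \<le> 4 * q\<close>.\<close>

lemma apex_and_size_estimates:
  fixes m k t N n D :: nat and s X :: real
  defines "s \<equiv> sqrt (real k * real m)"
  defines "X \<equiv> 2 ^ 6 * real m * s * real k powr (2 * s)"
  assumes "1 \<le> m" and "2 \<le> k" and D: "real D \<le> s" and "s < real D + 1"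
    and t: "t * (D + 1) \<le> m" and n: "X < real n + 1"
  shows "k ^ (k * t) < n + 1"
    and "n + 1 \<le> k ^ (k * t) * (N + 1) \<Longrightarrow>
      16 * real m ^ 3 * real k ^ (2 * D) \<le> real N ^ 2 \<and> 4 * real k ^ 2 * real m ^ 2 < real N"
proof -
  define q where "q = real k powr s"
  have km: "2 \<le> real k * real m"
    using mult_mono[of 2 "real k" 1 "real m"] assms(3,4) by simp
  have s2: "s ^ 2 = real k * real m"
    unfolding s_def by simp
  have s1: "1 \<le> s"
    unfolding s_def using km by simp
  have q1: "1 \<le> q"
    unfolding q_def using assms(4) s1 by (intro ge_one_powr_ge_zero) auto
  have X: "X = 64 * real m * s * q * q"
    unfolding X_def q_def by (simp add: powr_add[symmetric] mult.assoc)
  \<comment> \<open>This is where the threshold \<open>D\<close> is balanced: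
    \<open>t * s \<le> t * (D + 1) \<le> m\<close> and \<open>k * m = s * s\<close>.\<close>
  have kt: "real (k * t) \<le> s"
  proof -
    have "real (k * t) * s \<le> real (k * t) * (real D + 1)"
      using assms(6) by (intro mult_left_mono) auto
    also have "\<dots> = real k * real (t * (D + 1))"
      by (simp add: algebra_simps)
    also have "\<dots> \<le> real k * real m"
      using t by (intro mult_left_mono of_nat_mono) auto
    also have "\<dots> = s * s"
      using s2 by (simp add: power2_eq_square)
    finally show ?thesis
      using s1 by simp
  qed
  have pow_le: "real k ^ j \<le> q" if "real j \<le> s" for j
  proof -
    have "real k ^ j = real k powr real j"
      using assms(4) by (simp add: powr_realpow)
    also have "\<dots> \<le> q"
      unfolding q_def using assms(4) that by (intro powr_mono) auto
    finally show ?thesis .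
  qed
  have ms: "1 \<le> real m * s"
    using mult_mono[of 1 "real m" 1 s] assms(3) s1 by simp
  have msq: "1 \<le> real m * s * q"
    using mult_mono[of 1 "real m * s" 1 q] ms q1 by simp
  have "1 * q \<le> (64 * (real m * s * q)) * q"
    using msq q1 by (intro mult_right_mono) auto
  then have "q \<le> X"
    unfolding X by (simp add: mult_ac)
  then have "real k ^ (k * t) < real n + 1"
    using pow_le[OF kt] n by linarith
  then have "real (k ^ (k * t)) < real (n + 1)"
    by simp
  then show "k ^ (k * t) < n + 1"
    by (simp only: of_nat_less_iff)
  assume "n + 1 \<le> k ^ (k * t) * (N + 1)"
  then have "real (n + 1) \<le> real (k ^ (k * t) * (N + 1))"
    by (rule of_nat_mono)
  then have "real n + 1 \<le> real k ^ (k * t) * (real N + 1)"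
    by (simp add: algebra_simps)
  also have "\<dots> \<le> q * (real N + 1)"
    using pow_le[OF kt] by (intro mult_right_mono) auto
  finally have "q * (64 * (real m * s * q)) < q * (real N + 1)"
    using n unfolding X by (simp add: mult_ac)
  then have "64 * (real m * s * q) < real N + 1"
    using q1 by simp
  \<comment> \<open>Since \<open>m * s * q\<close> is at least 1, one of its 64 copies absorbs the
    summand 1.\<close>
  then have N: "63 * (real m * s * q) < real N"
    using msq by simp
  have "real k ^ (2 * D) = (real k ^ D) ^ 2"
    by (simp add: power_mult mult.commute)
  also have "\<dots> \<le> q ^ 2"
    using pow_le[OF D] by (intro power_mono) auto
  finally have kD: "real k ^ (2 * D) \<le> q ^ 2" .
  have "16 * real m ^ 3 * real k ^ (2 * D) \<le> 16 * real m ^ 3 * q ^ 2"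
    using kD by (intro mult_left_mono) auto
  also have "\<dots> \<le> (63 ^ 2 * real k) * (real m ^ 3 * q ^ 2)"
    using mult_right_mono[of 16 "63 ^ 2 * real k" "real m ^ 3 * q ^ 2"] assms(4) by simp
  also have "\<dots> = (63 * (real m * s * q)) ^ 2"
    by (simp add: power_mult_distrib s2 power3_eq_cube power2_eq_square[of "real m"])
  also have "\<dots> \<le> real N ^ 2"
    using N msq by (intro power_mono) auto
  finally have first: "16 * real m ^ 3 * real k ^ (2 * D) \<le> real N ^ 2" .
  \<comment> \<open>Preparation for \<open>k * s \<le> 4 * q\<close>: the tangent of
    \<open>exp\<close> at 0 gives \<open>s / 4 \<le> 2 powr (s - 1)\<close>, and the base 2 may be
    raised to \<open>k\<close>.\<close>
  have "s / 4 \<le> exp ((s - 1) * ln 2)"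
  proof -
    have "s / 4 \<le> 1 + (s - 1) * (1 / 2)"
      using s1 by (simp add: field_simps)
    also have "\<dots> \<le> 1 + (s - 1) * ln 2"
      using ln2_ge_two_thirds s1 by (intro add_left_mono mult_left_mono) auto
    also have "\<dots> \<le> exp ((s - 1) * ln 2)"
      by (rule exp_ge_add_one_self)
    finally show ?thesis .
  qed
  also have "\<dots> = 2 powr (s - 1)"
    by (simp add: powr_def)
  also have "\<dots> \<le> real k powr (s - 1)"
    using assms(4) s1 by (intro powr_mono2) auto
  finally have "real k * (s / 4) \<le> real k * real k powr (s - 1)"
    by (intro mult_left_mono) auto
  also have "\<dots> = q"
    using assms(4) unfolding q_def by (simp add: powr_diff)
  finally have "real k * s \<le> 4 * q"
    by simp
  then have "4 * (real m * s) * (real k * s) \<le> 4 * (real m * s) * (4 * q)"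
    using ms by (intro mult_left_mono) auto
  also have "4 * (real m * s) * (real k * s) = 4 * (real k * real m) * s ^ 2"
    by (simp add: power2_eq_square)
  also have "\<dots> = 4 * real k ^ 2 * real m ^ 2"
    unfolding s2 by (simp add: power2_eq_square)
  finally have "4 * real k ^ 2 * real m ^ 2 \<le> 16 * (real m * s * q)"
    by simp
  then have "4 * real k ^ 2 * real m ^ 2 < real N"
    using N msq by linarith
  then show "16 * real m ^ 3 * real k ^ (2 * D) \<le> real N ^ 2 \<and> 4 * real k ^ 2 * real m ^ 2 < real N"
    using first by blast
qed

section \<open>The bound on the Ramsey number\<close>

theorem theorem2:
  fixes V :: "'a set" and E :: "'a set set" and m k :: nat
  assumes "simple_graph V E"
    and "bipartite V E"
    and "card E = m"
    and "\<forall>v\<in>V. \<not> isolated E v"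
    and "k \<ge> 2"
  shows "real (ramsey_number k V E)
    \<le> 2 ^ 6 * real m powr (3 / 2) * real k powr (2 * sqrt (real k * real m) + 1 / 2)"
proof -
  have finV: "finite V" and EV: "E \<subseteq> [V]\<^bsup>2\<^esup>"
    using assms(1) by (auto simp: simple_graph_def)
  have finE: "finite E"
    using EV finite_imp_finite_nsets[OF finV] by (rule finite_subset)
  show ?thesis
  proof (cases "m = 0")
    \<comment> \<open>Without edges and isolated vertices the graph is empty. The Ramsey number is
      then 0, and so is the right-hand side.\<close>
    case True
    then have "E = {}"
      using finE assms(3) by simp
    moreover from this have "V = {}"
      using assms(4) by (auto simp: isolated_def)
    ultimately have "monochromatic_copy 0 c V E" for c
      using monochromatic_copyI[OF assms(1), of "\<lambda>_. 0" 0 c 0] by simp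
    then have "ramsey_property k V E 0"
      unfolding ramsey_property_def by blast
    then have "ramsey_number k V E = 0"
      unfolding ramsey_number_def by (metis Least_eq_0)
    then show ?thesis
      by simp
  next
    case False
    then have m: "1 \<le> m"
      by simp
    define s where "s = sqrt (real k * real m)"
    \<comment> \<open>As \<open>m * s\<close> equals \<open>m powr (3 / 2) * sqrt k\<close>, this is
      the claimed bound. Its floor serves as \<open>n\<close>, whence
      \<open>X < n + 1\<close>.\<close>
    define X where "X = 2 ^ 6 * real m * s * real k powr (2 * s)"
    define D where "D = nat \<lfloor>s\<rfloor>"
    define n where "n = nat \<lfloor>X\<rfloor>"
    have "1 \<le> real k * real m"
      using mult_mono[of 1 "real k" 1 "real m"] assms(5) m by simp
    then have s1: "1 \<le> s"
      unfolding s_def by simp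
    have D: "real D \<le> s" "s < real D + 1" "1 \<le> D"
      using s1 unfolding D_def by linarith+
    have "0 \<le> X"
      using s1 unfolding X_def by simp
    then have n: "real n \<le> X" "X < real n + 1"
      unfolding n_def by linarith+
    obtain A B where AB: "A \<union> B = V" "A \<inter> B = {}" and "\<forall>e\<in>E. \<exists>a\<in>A. \<exists>b\<in>B. e = {a, b}"
      using assms(2) unfolding bipartite_def by auto
    then have edges: "\<exists>a\<in>A. \<exists>b\<in>B. e = {a, b}" if "e \<in> E" for e
      using that by simp
    \<comment> \<open>The parts are exchanged so that the same edge count also bounds
      \<open>card B\<close>.\<close>
    have edges': "\<exists>b\<in>B. \<exists>a\<in>A. e = {b, a}" if "e \<in> E" for e
      using edges[OF that] by (metis insert_commute)
    have card_AB: "card A \<le> m" "card B \<le> m"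
      using card_part_le_card_edges[OF finE AB(2) edges] card_part_le_card_edges[OF finE _ edges']
        AB assms(3,4) by (auto simp: Int_commute)
    have "finite A" "finite B"
      using finV AB(1) by auto
    then have t: "card {a \<in> A. D < card {b \<in> B. {a, b} \<in> E}} * (D + 1) \<le> m"
      using card_high_degree_le[OF finE _ _ AB(2)] assms(3) by blast
    have "ramsey_property k V E n"
      using apex_and_size_estimates[OF m assms(5), folded s_def, folded X_def, OF D(1,2) t n(2)]
      by (intro ramsey_property_bipartite[OF assms(1) AB(1)[symmetric] AB(2) edges card_AB assms(5) D(3) refl]) auto
    then have "ramsey_number k V E \<le> n"
      unfolding ramsey_number_def by (rule Least_le)
    then have "real (ramsey_number k V E) \<le> X"
      using n(1) by linarith
    also have "X = 2 ^ 6 * real m powr (3 / 2) * real k powr (2 * s + 1 / 2)"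
    proof -
      have "real m powr (3 / 2) = real m * sqrt (real m)"
        using m powr_add[of "real m" 1 "1 / 2"] by (simp add: powr_half_sqrt)
      moreover have "real k powr (2 * s + 1 / 2) = real k powr (2 * s) * sqrt (real k)"
        by (simp add: powr_add powr_half_sqrt)
      ultimately show ?thesis
        unfolding X_def s_def by (simp add: real_sqrt_mult)
    qed
    finally show ?thesis
      unfolding s_def .
  qed
qed

end
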